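(* For every $n\ge2$, $$\left\{\kappa\ge1:\underline p_n(\kappa)=p_{n,n-1}(\kappa)\right\}=\begin{cases}[1,\infty),&n=2,\\ [1,4],&n=3,\\ \{1\},&n\ge4.\end{cases}$$ Moreover, if $n\ge4$ and $\kappa>1$, then $$p_{n,n-2}(\kappa)<p_{n,n-1}(\kappa).$$
   Context: For integers $1\le r\le n-1$ and $\kappa\ge1$ let $$P_{n,r,\kappa}(z):=(1-z)^r\Bigl(1+\frac{\kappa r}{n-r}z\Bigr)^{n-r},\qquad 0\le z\le1.$$ If $\kappa>1$, $p_{n,r}(\kappa)\in(0,1)$ denotes the unique solution $p\in(0,1)$ of $\int_0^1z^{-p}P'_{n,r,\kappa}(z)\,dz=0$. For $\kappa=1$, $p_{n,r}(1):=1$. Put $\underline p_n(\kappa):=\min_{1\le r\le n-1}p_{n,r}(\kappa)$. *)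

theory Defs
  imports "HOL-Analysis.Analysis"
begin

definition P_poly :: "nat \<Rightarrow> nat \<Rightarrow> real \<Rightarrow> real \<Rightarrow> real" where
  "P_poly n r \<kappa> z = (1 - z) ^ r * (1 + \<kappa> * real r / real (n - r) * z) ^ (n - r)"

text \<open>
  Only \<open>1 \<le> r \<le> n - 1\<close> and \<open>\<kappa> \<ge> 1\<close> are meaningful. Using \<open>has_integral\<close> makes integrability
  part of the equation; the value \<open>0 powr (- p) = 0\<close> at the endpoint does not matter.
\<close>
definition p_exp :: "nat \<Rightarrow> nat \<Rightarrow> real \<Rightarrow> real" where
  "p_exp n r \<kappa> =
     (if \<kappa> = 1 then 1
      else (THE p. 0 < p \<and> p < 1 \<and>
              ((\<lambda>z. z powr (- p) * deriv (P_poly n r \<kappa>) z) has_integral 0) {0..1}))"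

definition p_min :: "nat \<Rightarrow> real \<Rightarrow> real" where
  "p_min n \<kappa> = Min ((\<lambda>r. p_exp n r \<kappa>) ` {1..n - 1})"

end

theory Submission
  imports Defs
begin

text \<open>
  The derivative of \<^term>\<open>P_poly n r \<kappa>\<close> is \<open>(1 - z) ^ (r - 1)\<close> times a polynomial of degree
  \<open>n - r\<close>. Integrating it against \<open>z powr - p\<close> therefore gives a combination of moments of a Beta
  distribution with parameters \<open>s = 1 - p\<close> and \<open>r\<close>, that is, the positive number \<open>Beta s r\<close> times
  a rational function of \<open>s\<close>. So the integral equation for \<open>p\<close> is algebraic, and only two
  of these equations matter.

  Let \<open>\<kappa> > 1\<close>. For \<open>r = n - 1\<close> the equation is linear and gives \<open>p = n / ((n - 1) \<kappa> + 1)\<close>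
  (\<open>p_exp_last\<close>). For \<open>r = n - 2\<close> it says that a quadratic \<open>Q\<close> vanishes at \<open>s\<close>, where
  \<open>Q 0 > 0 > Q 1\<close>; such a quadratic has exactly one root in the unit interval and is positive
  exactly to the left of it. Hence the two exponents are compared by the sign of \<open>Q\<close> at the explicit
  value \<open>s = 1 - n / ((n - 1) \<kappa> + 1)\<close>. There everything cancels except a positive multiple of
  \<open>\<kappa> (n - 2)\<^sup>2 - 4\<close>, so for \<open>n \<ge> 3\<close> and \<open>\<kappa> > 1\<close>
  \<open>p_exp n (n - 2) \<kappa> < p_exp n (n - 1) \<kappa>\<close> holds if and only if
  \<open>4 < \<kappa> (n - 2)\<^sup>2\<close> (\<open>p_exp_penultimate_less_iff\<close>).

  For \<open>n \<ge> 4\<close> and \<open>\<kappa> > 1\<close> the inequality is automatic, and \<open>r = n - 1\<close> is not minimal. For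
  \<open>n = 3\<close> there are no further values of \<open>r\<close>, and the condition \<open>\<kappa> \<le> 4\<close> is left over.
\<close>

lemma deriv_P_poly:
  assumes "1 \<le> r" "r < n"
  shows "deriv (P_poly n r \<kappa>) z =
    (1 - z) ^ (r - 1) * (real r * (1 + \<kappa> * real r / real (n - r) * z) ^ (n - r - 1)
      * (\<kappa> - 1 - \<kappa> * real n / real (n - r) * z))"
proof -
  define a where "a = \<kappa> * real r / real (n - r)"
  have pow: "(1 - z) ^ r = (1 - z) * (1 - z) ^ (r - 1)"
    "(1 + a * z) ^ (n - r) = (1 + a * z) * (1 + a * z) ^ (n - r - 1)"
    using assms power_minus_mult[of r "1 - z"] power_minus_mult[of "n - r" "1 + a * z"]
    by (simp_all add: mult.commute)
  have ma: "real (n - r) * a = \<kappa> * real r"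
    and na: "\<kappa> * real n / real (n - r) = \<kappa> + a"
    using assms by (auto simp: a_def field_simps of_nat_diff)
  have "P_poly n r \<kappa> = (\<lambda>z. (1 - z) ^ r * (1 + a * z) ^ (n - r))"
    by (simp add: P_poly_def a_def fun_eq_iff)
  moreover have "((\<lambda>z. (1 - z) ^ r * (1 + a * z) ^ (n - r)) has_real_derivative
     (1 - z) ^ (r - 1) * (1 + a * z) ^ (n - r - 1)
       * ((real (n - r) * a) * (1 - z) - real r * (1 + a * z))) (at z)"
    by (rule derivative_eq_intros refl)+ (simp add: pow algebra_simps)
  ultimately have "deriv (P_poly n r \<kappa>) z = (1 - z) ^ (r - 1) * (1 + a * z) ^ (n - r - 1)
       * ((real (n - r) * a) * (1 - z) - real r * (1 + a * z))"
    by (simp add: DERIV_imp_deriv)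
  then show ?thesis
    unfolding ma na a_def[symmetric] by (simp add: algebra_simps)
qed

lemma has_integral_Beta_moment:
  fixes s :: real
  assumes "0 < s" "1 \<le> r"
  shows "((\<lambda>z. z powr (s - 1) * (1 - z) ^ (r - 1) * z ^ k) has_integral Beta (s + real k) (real r)) {0..1}"
proof (rule has_integral_spike_finite)
  show "((\<lambda>z. z powr (s + real k - 1) * (1 - z) powr (real r - 1)) has_integral
      Beta (s + real k) (real r)) {0..1}"
    using assms by (intro has_integral_Beta_real) auto
  show "finite {0, 1::real}"
    by simp
  fix z :: real assume "z \<in> {0..1} - {0, 1}"
  then have "(1 - z) ^ (r - 1) = (1 - z) powr (real r - 1)" "z ^ k = z powr real k"
    using assms by (auto simp: powr_realpow[symmetric] of_nat_diff)
  then show "z powr (s - 1) * (1 - z) ^ (r - 1) * z ^ k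
      = z powr (s + real k - 1) * (1 - z) powr (real r - 1)"
    by (simp add: powr_add[symmetric] algebra_simps)
qed

text \<open>
  The first two moments of the Beta distribution are \<open>s / (s + r)\<close> and
  \<open>s (s + 1) / ((s + r) (s + r + 1))\<close>; here they are brought to a common denominator.
\<close>
lemma has_integral_Beta_quadratic:
  fixes s :: real
  assumes "0 < s" "1 \<le> r"
  shows "((\<lambda>z. z powr (s - 1) * ((1 - z) ^ (r - 1) * (A + B * z + C * z\<^sup>2))) has_integral
    Beta s (real r) / ((s + r) * (s + r + 1))
      * (A * (s + r) * (s + r + 1) + B * s * (s + r + 1) + C * s * (s + 1))) {0..1}"
proof -
  let ?r = "real r"
  have nonpos: "s \<notin> \<int>\<^sub>\<le>\<^sub>0" "s + 1 \<notin> \<int>\<^sub>\<le>\<^sub>0"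
    using assms by (auto elim!: nonpos_Ints_cases)
  have 1: "Beta (s + 1) ?r = Beta s ?r * s / (s + ?r)"
    using Beta_plus1_left[OF nonpos(1), of ?r] assms by (simp add: field_simps)
  have 2: "Beta (s + 2) ?r = Beta s ?r * s * (s + 1) / ((s + ?r) * (s + ?r + 1))"
  proof -
    have "(s + ?r + 1) * Beta (s + 2) ?r = (s + 1) * Beta (s + 1) ?r"
      using Beta_plus1_left[OF nonpos(2), of ?r] by (simp add: add_ac)
    also have "\<dots> = (s + 1) * (Beta s ?r * s / (s + ?r))"
      by (simp only: 1)
    finally have "Beta (s + 2) ?r = (s + 1) * (Beta s ?r * s / (s + ?r)) / (s + ?r + 1)"
      using assms by (simp add: eq_divide_eq mult_ac)
    then show ?thesis
      by (simp add: mult_ac)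
  qed
  note moment = has_integral_Beta_moment[OF assms]
  have "((\<lambda>z. z powr (s - 1) * (1 - z) ^ (r - 1) * z ^ 0 * A
       + z powr (s - 1) * (1 - z) ^ (r - 1) * z ^ 1 * B
       + z powr (s - 1) * (1 - z) ^ (r - 1) * z ^ 2 * C) has_integral
      (Beta (s + real 0) ?r * A + Beta (s + real 1) ?r * B + Beta (s + real 2) ?r * C)) {0..1}"
    by (intro has_integral_add has_integral_mult_left moment)
  moreover have "Beta (s + real 0) ?r * A + Beta (s + real 1) ?r * B + Beta (s + real 2) ?r * C
     = Beta s ?r / ((s + r) * (s + r + 1))
      * (A * (s + r) * (s + r + 1) + B * s * (s + r + 1) + C * s * (s + 1))"
  proof -
    define b where "b = Beta s ?r / ((s + r) * (s + r + 1))"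
    have "Beta s ?r = b * ((s + r) * (s + r + 1))" "Beta (s + 1) ?r = b * s * (s + r + 1)"
      "Beta (s + 2) ?r = b * s * (s + 1)"
      using assms unfolding 1 2 b_def by simp_all
    then show ?thesis
      unfolding b_def[symmetric] by (simp add: algebra_simps)
  qed
  ultimately show ?thesis
    by (simp add: algebra_simps)
qed

text \<open>
  When the derivative is \<open>(1 - z) ^ (r - 1)\<close> times a polynomial of degree at most two, the
  Beta factor drops out and the defining equation becomes polynomial in \<open>1 - p\<close>.
\<close>
lemma p_exp_eq_THE_root:
  fixes \<kappa> A B C :: real and r :: nat
  defines "Q \<equiv> \<lambda>s::real. A * (s + r) * (s + r + 1) + B * s * (s + r + 1) + C * s * (s + 1)"
  assumes "1 \<le> r" "\<kappa> \<noteq> 1"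
    and deriv: "\<And>z. deriv (P_poly n r \<kappa>) z = (1 - z) ^ (r - 1) * (A + B * z + C * z\<^sup>2)"
    and unique: "\<exists>!s. 0 < s \<and> s < 1 \<and> Q s = 0"
  shows "p_exp n r \<kappa> = 1 - (THE s. 0 < s \<and> s < 1 \<and> Q s = 0)"
proof -
  have *: "((\<lambda>z. z powr - p * deriv (P_poly n r \<kappa>) z) has_integral 0) {0..1} \<longleftrightarrow> Q (1 - p) = 0"
    if "0 < p" "p < 1" for p
  proof -
    define c where "c = Beta (1 - p) r / ((1 - p + r) * (1 - p + r + 1))"
    have "((\<lambda>z. z powr - p * deriv (P_poly n r \<kappa>) z) has_integral c * Q (1 - p)) {0..1}"
      using has_integral_Beta_quadratic[of "1 - p" r A B C] that assms(2)
      unfolding deriv Q_def c_def by simp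
    moreover have "c > 0"
      using that assms(2) unfolding Beta_def c_def
      by (intro divide_pos_pos mult_pos_pos Gamma_real_pos) auto
    ultimately show ?thesis
      using has_integral_unique[of _ "c * Q (1 - p)" "{0..1}" 0] by (cases "Q (1 - p) = 0") auto
  qed
  from unique obtain s where s: "0 < s" "s < 1" "Q s = 0"
    and s_unique: "\<And>t. 0 < t \<Longrightarrow> t < 1 \<Longrightarrow> Q t = 0 \<Longrightarrow> t = s"
    by blast
  have "(THE p. 0 < p \<and> p < 1 \<and>
      ((\<lambda>z. z powr - p * deriv (P_poly n r \<kappa>) z) has_integral 0) {0..1}) = 1 - s"
  proof (rule the_equality)
    show "0 < 1 - s \<and> 1 - s < 1 \<and>
        ((\<lambda>z. z powr - (1 - s) * deriv (P_poly n r \<kappa>) z) has_integral 0) {0..1}"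
      using s *[of "1 - s"] by simp
    show "p = 1 - s" if "0 < p \<and> p < 1 \<and>
        ((\<lambda>z. z powr - p * deriv (P_poly n r \<kappa>) z) has_integral 0) {0..1}" for p
      using that *[of p] s_unique[of "1 - p"] by simp
  qed
  moreover have "(THE s. 0 < s \<and> s < 1 \<and> Q s = 0) = s"
    using s s_unique by blast
  ultimately show ?thesis
    using \<open>\<kappa> \<noteq> 1\<close> by (simp add: p_exp_def)
qed

lemma p_exp_last:
  assumes "n \<ge> 2" "\<kappa> > 1"
  shows "p_exp n (n - 1) \<kappa> = real n / ((real n - 1) * \<kappa> + 1)"
proof -
  define r where "r = n - 1"
  have n: "n = Suc r" and r: "1 \<le> r"
    using assms by (auto simp: r_def)
  define A where "A = real r * (\<kappa> - 1)"
  define B where "B = - real r * \<kappa> * real n"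
  define Q where "Q = (\<lambda>s::real. A * (s + r) * (s + r + 1) + B * s * (s + r + 1) + 0 * s * (s + 1))"
  define s where "s = real r * (\<kappa> - 1) / (real r * \<kappa> + 1)"
  have pos: "0 < real r * \<kappa> + 1"
    using assms by (intro add_nonneg_pos) auto
  have "real r * (\<kappa> - 1) < real r * \<kappa> + 1"
    by (simp add: algebra_simps)
  then have s: "0 < s" "s < 1"
    using assms r pos by (auto simp: s_def)
  \<comment> \<open>The quadratic term is absent, so the common denominator of the moments contributes the
    spurious factor \<open>t + r + 1\<close>, which is positive in the relevant range.\<close>
  have Q: "Q t = real r * (t + r + 1) * (real r * (\<kappa> - 1) - (real r * \<kappa> + 1) * t)" for t
    by (simp add: Q_def A_def B_def n algebra_simps)
  have root: "Q t = 0 \<longleftrightarrow> t = s" if "0 < t" for t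
  proof -
    have "real r * (t + r + 1) \<noteq> 0"
      using that r by simp
    then have "Q t = 0 \<longleftrightarrow> real r * (\<kappa> - 1) - (real r * \<kappa> + 1) * t = 0"
      unfolding Q by simp
    also have "\<dots> \<longleftrightarrow> t = s"
      using pos unfolding s_def by (auto simp: eq_divide_eq mult.commute)
    finally show ?thesis .
  qed
  have deriv: "deriv (P_poly n r \<kappa>) z = (1 - z) ^ (r - 1) * (A + B * z + 0 * z\<^sup>2)" for z
    using deriv_P_poly[of r n \<kappa> z] r by (simp add: n A_def B_def algebra_simps)
  have "p_exp n r \<kappa> = 1 - (THE s. 0 < s \<and> s < 1 \<and> Q s = 0)"
    unfolding Q_def
    by (rule p_exp_eq_THE_root[OF r _ deriv]) (use assms s root Q_def in auto)
  also have "(THE s. 0 < s \<and> s < 1 \<and> Q s = 0) = s"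
    using s root by (intro the_equality) auto
  also have "1 - s = real n / ((real n - 1) * \<kappa> + 1)"
    using pos by (simp add: s_def n field_simps)
  finally show ?thesis
    by (simp add: r_def)
qed

text \<open>
  A quadratic with two distinct roots in the interior of the unit interval has values of the same
  sign at \<open>0\<close> and \<open>1\<close>. The position of \<open>t\<close> relative to the root then follows from the
  intermediate value theorem on one side of \<open>t\<close>.
\<close>
lemma quadratic_unique_root:
  fixes q :: "real \<Rightarrow> real"
  assumes q: "\<And>x. q x = a * x\<^sup>2 + b * x + c" and "q 0 > 0" "q 1 < 0"
  shows "\<exists>!x. 0 < x \<and> x < 1 \<and> q x = 0"
    and "0 < t \<Longrightarrow> t < 1 \<Longrightarrow> t < (THE x. 0 < x \<and> x < 1 \<and> q x = 0) \<longleftrightarrow> q t > 0"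
proof -
  have cont: "continuous_on S q" for S
    unfolding q[abs_def] by (intro continuous_intros)
  have no_two: False if "0 < x" "x < y" "y < 1" "q x = 0" "q y = 0" for x y
  proof -
    have "(x - y) * (a * (x + y) + b) = q x - q y"
      unfolding q by (simp add: algebra_simps power2_eq_square)
    then have b: "b = - a * (x + y)"
      using that by simp
    have "q x = c - a * x * y"
      unfolding q b by (simp add: algebra_simps power2_eq_square)
    then have c: "c = a * x * y"
      using that by simp
    have "q 0 = a * (x * y)" "q 1 = a * ((1 - x) * (1 - y))"
      unfolding q b c by (simp_all add: algebra_simps)
    moreover have "x * y > 0" "(1 - x) * (1 - y) > 0"
      using that by simp_all
    ultimately show False
      using assms(2,3) by (metis zero_less_mult_pos2 mult_pos_pos less_asym)
  qed
  have root: "\<exists>x. u < x \<and> x < v \<and> q x = 0" if uv: "u < v" "q u > 0" "q v < 0" for u v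
  proof -
    obtain x where "u \<le> x" "x \<le> v" "q x = 0"
      using IVT2'[of q v 0 u, OF _ _ _ cont] uv by auto
    moreover from this have "x \<noteq> u" "x \<noteq> v"
      using uv by auto
    ultimately show ?thesis
      by (intro exI[of _ x]) auto
  qed
  obtain x where x: "0 < x" "x < 1" "q x = 0"
    using root[of 0 1] assms by auto
  have x_unique: "y = x" if "0 < y" "y < 1" "q y = 0" for y
    using no_two[of x y] no_two[of y x] that x by (cases y x rule: linorder_cases) auto
  show "\<exists>!x. 0 < x \<and> x < 1 \<and> q x = 0"
    using x x_unique by blast
  have THE: "(THE x. 0 < x \<and> x < 1 \<and> q x = 0) = x"
    using x x_unique by blast
  assume t: "0 < t" "t < 1"
  consider "q t > 0" | "q t = 0" | "q t < 0"
    by linarith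
  then show "t < (THE x. 0 < x \<and> x < 1 \<and> q x = 0) \<longleftrightarrow> q t > 0"
    unfolding THE
  proof cases
    case 1
    then obtain y where "t < y" "y < 1" "q y = 0"
      using root[of t 1] t assms by auto
    then show "t < x \<longleftrightarrow> q t > 0"
      using x_unique[of y] t 1 by auto
  next
    case 2
    then show "t < x \<longleftrightarrow> q t > 0"
      using x_unique[of t] t by auto
  next
    case 3
    then obtain y where "0 < y" "y < t" "q y = 0"
      using root[of 0 t] t assms by auto
    then show "t < x \<longleftrightarrow> q t > 0"
      using x_unique[of y] t 3 by auto
  qed
qed

text \<open>
  The quadratic for \<open>r = n - 2\<close> need not be solved: since it is positive exactly below its root,
  its sign at one minus the explicit exponent for \<open>r = n - 1\<close> decides the comparison.
\<close>
lemma p_exp_penultimate_less_iff: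
  assumes "n \<ge> 3" "\<kappa> > 1"
  shows "p_exp n (n - 2) \<kappa> < p_exp n (n - 1) \<kappa> \<longleftrightarrow> 4 < \<kappa> * (real n - 2)\<^sup>2"
proof -
  define r where "r = n - 2"
  have n: "n = Suc (Suc r)" and r: "1 \<le> r"
    using assms by (auto simp: r_def)
  define a where "a = \<kappa> * real r / 2"
  have nk: "\<kappa> * real n / 2 = \<kappa> + a"
    by (simp add: n a_def field_simps)
  define A where "A = real r * (\<kappa> - 1)"
  define B where "B = real r * (a * (\<kappa> - 1) - (\<kappa> + a))"
  define C where "C = - real r * a * (\<kappa> + a)"
  define Q where "Q = (\<lambda>s::real. A * (s + r) * (s + r + 1) + B * s * (s + r + 1) + C * s * (s + 1))"
  define root where "root = (THE s. 0 < s \<and> s < 1 \<and> Q s = 0)"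
  have deriv: "deriv (P_poly n r \<kappa>) z = (1 - z) ^ (r - 1) * (A + B * z + C * z\<^sup>2)" for z
  proof -
    have "deriv (P_poly n r \<kappa>) z =
        (1 - z) ^ (r - 1) * (real r * (1 + a * z) * (\<kappa> - 1 - (\<kappa> + a) * z))"
      using deriv_P_poly[of r n \<kappa> z] r unfolding nk[symmetric] by (simp add: n a_def)
    also have "real r * (1 + a * z) * (\<kappa> - 1 - (\<kappa> + a) * z) = A + B * z + C * z\<^sup>2"
      by (simp add: A_def B_def C_def algebra_simps power2_eq_square)
    finally show ?thesis .
  qed
  have quad: "Q x = (A + B + C) * x\<^sup>2 + (A * (2 * r + 1) + B * (r + 1) + C) * x + A * r * (r + 1)" for x
    by (simp add: Q_def algebra_simps power2_eq_square)
  have Q0: "Q 0 > 0"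
    using assms r by (simp add: Q_def A_def)
  have "Q 1 = - real r * (r + 1) * (r + 2)"
    by (simp add: Q_def A_def B_def C_def a_def field_simps)
  then have Q1: "Q 1 < 0"
    using r by (simp add: mult_less_0_iff)
  note unique = quadratic_unique_root[of Q, OF quad Q0 Q1]
  have p: "p_exp n (n - 2) \<kappa> = 1 - root"
    unfolding Q_def root_def r_def[symmetric]
    by (rule p_exp_eq_THE_root[OF r _ deriv]) (use assms unique(1) Q_def in auto)

  \<comment> \<open>The exponent for \<open>r = n - 1\<close> is \<open>1 - t\<close>. Each linear factor of \<open>Q t\<close> simplifies
    once it is multiplied by the denominator \<open>D\<close> of \<open>t\<close>, so \<open>D\<^sup>2\<close> clears \<open>Q t\<close>; the factor \<open>4\<close>
    clears the halves in \<open>a (\<kappa> + a)\<close>.\<close>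
  define D where "D = (real r + 1) * \<kappa> + 1"
  define t where "t = (real r + 1) * (\<kappa> - 1) / D"
  have D: "D > 0"
    using assms by (auto simp: D_def intro!: add_nonneg_pos)
  have pt: "p_exp n (n - 1) \<kappa> = 1 - t"
    using p_exp_last[of n \<kappa>] assms D by (simp add: n t_def D_def field_simps)
  have t: "0 < t" "t < 1"
    using assms D by (simp_all add: t_def divide_less_eq) (simp add: D_def algebra_simps)
  have Dt: "D * t = (real r + 1) * (\<kappa> - 1)"
    using D by (simp add: t_def)
  have Dt': "D * (t + r) = (real r + 1)\<^sup>2 * \<kappa> - 1"
    "D * (t + r + 1) = (real r + 1) * (real r + 2) * \<kappa>"
    "D * (t + 1) = 2 * (real r + 1) * \<kappa> - real r"
    using Dt by (simp_all add: D_def algebra_simps power2_eq_square)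
  have "4 * D\<^sup>2 * Q t = 4 * A * (D * (t + r)) * (D * (t + r + 1))
      + 4 * B * (D * t) * (D * (t + r + 1)) + 4 * C * (D * t) * (D * (t + 1))"
    by (simp add: Q_def algebra_simps power2_eq_square)
  also have "\<dots> = real r * (r + 1) * (r + 2) * \<kappa> * (\<kappa> - 1) * (\<kappa> * (real r)\<^sup>2 - 4)"
    unfolding Dt Dt' A_def B_def C_def a_def by (simp add: field_simps power2_eq_square)
  finally have eq: "4 * D\<^sup>2 * Q t = \<dots>" .
  have pos: "real r * (r + 1) * (r + 2) * \<kappa> * (\<kappa> - 1) > 0" "4 * D\<^sup>2 > 0"
    using assms r D by auto
  have "p_exp n (n - 2) \<kappa> < p_exp n (n - 1) \<kappa> \<longleftrightarrow> t < root"
    unfolding p pt by simp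
  also have "\<dots> \<longleftrightarrow> Q t > 0"
    unfolding root_def using unique(2) t by blast
  also have "\<dots> \<longleftrightarrow> 4 * D\<^sup>2 * Q t > 0"
    using pos(2) by (simp add: zero_less_mult_iff)
  also have "\<dots> \<longleftrightarrow> \<kappa> * (real r)\<^sup>2 - 4 > 0"
    unfolding eq using zero_less_mult_pos pos(1) mult_pos_pos by blast
  finally show ?thesis
    by (simp add: n)
qed

theorem proposition6p2:
  fixes n :: nat
  assumes "n \<ge> 2"
  shows "{\<kappa>::real. \<kappa> \<ge> 1 \<and> p_min n \<kappa> = p_exp n (n - 1) \<kappa>} =
           (if n = 2 then {1..} else if n = 3 then {1..4} else {1})
         \<and> (n \<ge> 4 \<longrightarrow> (\<forall>\<kappa>::real. \<kappa> > 1 \<longrightarrow> p_exp n (n - 2) \<kappa> < p_exp n (n - 1) \<kappa>))"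
proof -
  have one: "p_min n 1 = p_exp n (n - 1) 1"
    using assms by (simp add: p_min_def p_exp_def image_constant_conv)
  have less: "p_exp n (n - 2) \<kappa> < p_exp n (n - 1) \<kappa>" if "n \<ge> 4" "\<kappa> > 1" for \<kappa>
  proof -
    have "2\<^sup>2 \<le> (real n - 2)\<^sup>2"
      using that by (intro power_mono) auto
    then have "4 * 1 < (real n - 2)\<^sup>2 * \<kappa>"
      using that by (intro mult_le_less_imp_less) auto
    then show ?thesis
      using p_exp_penultimate_less_iff[of n \<kappa>] that by (simp add: mult.commute)
  qed
  have "{\<kappa>. \<kappa> \<ge> 1 \<and> p_min n \<kappa> = p_exp n (n - 1) \<kappa>} =
           (if n = 2 then {1..} else if n = 3 then {1..4} else {1})"
  proof -
    consider "n = 2" | "n = 3" | "n \<ge> 4"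
      using assms by linarith
    then show ?thesis
    proof cases
      case 1
      then show ?thesis
        by (auto simp: p_min_def)
    next
      case 2
      have "{1..2::nat} = {1, 2}"
        by auto
      then have "p_min n \<kappa> = min (p_exp n 1 \<kappa>) (p_exp n 2 \<kappa>)" for \<kappa>
        using 2 by (simp add: p_min_def)
      then have min: "p_min n \<kappa> = p_exp n (n - 1) \<kappa> \<longleftrightarrow> \<not> p_exp n (n - 2) \<kappa> < p_exp n (n - 1) \<kappa>"
        for \<kappa>
        using 2 by (auto simp: min_def)
      have "p_min n \<kappa> = p_exp n (n - 1) \<kappa> \<longleftrightarrow> \<kappa> \<le> 4" if "\<kappa> \<ge> 1" for \<kappa>
      proof (cases "\<kappa> = 1")
        case True
        then show ?thesis
          using one by simp
      next
        case False
        then have "p_exp n (n - 2) \<kappa> < p_exp n (n - 1) \<kappa> \<longleftrightarrow> 4 < \<kappa>"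
          using p_exp_penultimate_less_iff[of n \<kappa>] that 2 by simp
        then show ?thesis
          unfolding min by linarith
      qed
      then have "{\<kappa>. \<kappa> \<ge> 1 \<and> p_min n \<kappa> = p_exp n (n - 1) \<kappa>} = {1..4}"
        unfolding atLeastAtMost_def by blast
      then show ?thesis
        using 2 by simp
    next
      case 3
      have "p_min n \<kappa> \<noteq> p_exp n (n - 1) \<kappa>" if "\<kappa> > 1" for \<kappa>
      proof -
        have "p_min n \<kappa> \<le> p_exp n (n - 2) \<kappa>"
          unfolding p_min_def using 3 by (intro Min_le imageI) auto
        then show ?thesis
          using less[OF 3 that] by simp
      qed
      then have "\<kappa> \<ge> 1 \<and> p_min n \<kappa> = p_exp n (n - 1) \<kappa> \<longleftrightarrow> \<kappa> = 1" for \<kappa>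
        using one by (cases "\<kappa> > 1") auto
      then show ?thesis
        using 3 by auto
    qed
  qed
  then show ?thesis
    using less by blast
qed

end
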